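(* Let $a<b$ be real numbers, let $\overline{n}=(n_k)_{k\in\mathbb{N}}$ be a strictly increasing sequence of natural numbers, and let $C_{\overline{n}}([a,b])$ be the associated quasi-analytic class. Then: (1) (Monotonicity) If $f\in C_{\overline{n}}([a,b])$ satisfies $f^{(n)}(a)>0$ for all $n\in\mathbb{N}$, then $f^{(n)}(x)>0$ for all $n\in\mathbb{N}$ and all $x\in[a,b]$. (2) (Non-surjectivity of the Borel mapping) If $C_{\overline{n}}([a,b])$ strictly contains the class of real analytic functions on $[a,b]$, then for every $c\in[a,b]$ the Borel mapping $$T_c: C_{\overline{n}}([a,b])\to\mathbb{R}[[x]],\qquad T_c(f)=\sum_{n=0}^\infty\frac{f^{(n)}(c)}{n!}x^n,$$ is not surjective.
   Context: $\mathbb{N}=\{0,1,2,\dots\}$, and $C^\infty([a,b])$ denotes the real-valued infinitely differentiable functions on $[a,b]$ (one-sided derivatives at the endpoints). For $f\in C^\infty([a,b])$ put $M_n(f)=\sup_{x\in[a,b]}|f^{(n)}(x)|$. For a strictly increasing sequence of natural numbers $\overline{n}=(n_k)_{k\in\mathbb{N}}$, $C_{\overline{n}}([a,b])$ is the set of all $f\in C^\infty([a,b])$ for which there exist constants $A,B>0$ (depending on $f$) such that $M_{n_k}(f)\le B A^{n_k}\, n_k!$ for all $k\in\mathbb{N}$. $\mathbb{R}[[x]]$ is the ring of formal power series in one variable with real coefficients. *)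

theory Defs
  imports "HOL-Analysis.Analysis" "HOL-Computational_Algebra.Formal_Power_Series"
begin

text \<open>Functions on \<open>[a,b]\<close> are represented by total functions \<open>real \<Rightarrow> real\<close>. For \<open>a < b\<close> all
  notions below depend only on the values on \<open>[a,b]\<close>: derivatives are taken within
  \<open>{a..b}\<close>, hence are one-sided at the endpoints (and unspecified outside \<open>[a,b]\<close>).\<close>

definition deriv_within :: "real set \<Rightarrow> (real \<Rightarrow> real) \<Rightarrow> real \<Rightarrow> real" where
  "deriv_within S f = (\<lambda>x. vector_derivative f (at x within S))"

definition nth_deriv :: "real \<Rightarrow> real \<Rightarrow> nat \<Rightarrow> (real \<Rightarrow> real) \<Rightarrow> real \<Rightarrow> real" where
  "nth_deriv a b n f = (deriv_within {a..b} ^^ n) f"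

definition C_infinity :: "real \<Rightarrow> real \<Rightarrow> (real \<Rightarrow> real) set" where
  "C_infinity a b = {f. \<forall>n. nth_deriv a b n f differentiable_on {a..b}}"

definition M_sup :: "real \<Rightarrow> real \<Rightarrow> nat \<Rightarrow> (real \<Rightarrow> real) \<Rightarrow> real" where
  "M_sup a b n f = (SUP x\<in>{a..b}. \<bar>nth_deriv a b n f x\<bar>)"

definition C_class :: "(nat \<Rightarrow> nat) \<Rightarrow> real \<Rightarrow> real \<Rightarrow> (real \<Rightarrow> real) set" where
  "C_class N a b = {f \<in> C_infinity a b. \<exists>A>0. \<exists>B>0. \<forall>k. M_sup a b (N k) f \<le> B * A ^ N k * fact (N k)}"

text \<open>Local expansion into a convergent power series at every point of \<open>[a,b]\<close>, endpoints
  included; equivalently, restrictions of real analytic functions on open neighbourhoods.\<close>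

definition C_analytic :: "real \<Rightarrow> real \<Rightarrow> (real \<Rightarrow> real) set" where
  "C_analytic a b = {f. \<forall>c\<in>{a..b}. \<exists>r>0. \<exists>u :: nat \<Rightarrow> real.
     \<forall>x\<in>{a..b}. \<bar>x - c\<bar> < r \<longrightarrow> (\<lambda>n. u n * (x - c) ^ n) sums f x}"

definition Borel_map :: "real \<Rightarrow> real \<Rightarrow> real \<Rightarrow> (real \<Rightarrow> real) \<Rightarrow> real fps" where
  "Borel_map a b c f = Abs_fps (\<lambda>n. nth_deriv a b n f c / fact n)"

end

theory Submission
  imports Defs "HOL-Real_Asymp.Real_Asymp"
begin

text \<open>Since \<open>M\<^bsub>n\<^sub>k\<^esub>(f) \<le> B A\<^bsup>n\<^sub>k\<^esup> n\<^sub>k!\<close>, the Taylor polynomials of \<open>f\<^bsup>(m)\<^esup>\<close> at any point \<open>c\<close>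
  of degree below \<open>n\<^sub>k - m\<close> converge to \<open>f\<^bsup>(m)\<^esup>\<close> on \<open>\<bar>x - c\<bar> < 1/A\<close>; the radius does not depend on \<open>c\<close>.
  If all derivatives at \<open>c\<close> are positive, each of these polynomials is at least \<open>f\<^bsup>(m)\<^esup>(c)\<close> to the
  right of \<open>c\<close>, so positivity propagates from \<open>a\<close> to \<open>b\<close> in steps of length \<open>1/(2A)\<close>.
  The series \<open>\<Sum> n! x\<^sup>n\<close> (or \<open>\<Sum> n! (-x)\<^sup>n\<close> if \<open>c = b\<close>) is not in the image of the Borel map, because
  on one side of \<open>c\<close> all its terms are positive and its partial sums diverge, while those of length
  \<open>n\<^sub>k\<close> would have to converge.\<close>

lemma nth_deriv_has_field_derivative:
  assumes "a < b" "f \<in> C_infinity a b" "x \<in> {a..b}"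
  shows "(nth_deriv a b n f has_field_derivative nth_deriv a b (Suc n) f x) (at x within {a..b})"
proof -
  have "nth_deriv a b n f differentiable (at x within {a..b})"
    using assms by (auto simp: C_infinity_def differentiable_on_def)
  then have "(nth_deriv a b n f has_vector_derivative
      vector_derivative (nth_deriv a b n f) (at x within {a..b})) (at x within {a..b})"
    by (simp add: vector_derivative_works)
  then show ?thesis
    by (simp add: nth_deriv_def deriv_within_def has_real_derivative_iff_has_vector_derivative)
qed

text \<open>A real \<open>SUP\<close> is an upper bound only when the set is bounded above;
  continuity on the compact interval supplies this.\<close>

lemma abs_nth_deriv_le_M_sup:
  assumes "f \<in> C_infinity a b" "x \<in> {a..b}"
  shows "\<bar>nth_deriv a b n f x\<bar> \<le> M_sup a b n f"
proof -
  have "continuous_on {a..b} (\<lambda>x. \<bar>nth_deriv a b n f x\<bar>)"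
    using assms
    by (intro continuous_on_rabs differentiable_imp_continuous_on) (auto simp: C_infinity_def)
  then have "bdd_above ((\<lambda>x. \<bar>nth_deriv a b n f x\<bar>) ` {a..b})"
    by (intro bounded_imp_bdd_above compact_imp_bounded compact_continuous_image) auto
  then show ?thesis
    unfolding M_sup_def using assms(2) by (rule cSUP_upper[rotated])
qed

lemma polynomial_times_power_tendsto_0:
  fixes q :: real
  assumes "0 \<le> q" "q < 1"
  shows "(\<lambda>p. (real p + real m) ^ l * q ^ p) \<longlonglongrightarrow> 0"
proof (cases "q = 0")
  case True
  \<comment> \<open>Only eventually: at \<open>p = 0\<close> the factor \<open>0 ^ 0\<close> equals
    1.\<close>
  have "\<forall>\<^sub>F p in sequentially. (real p + real m) ^ l * q ^ p = 0"
    using eventually_gt_at_top[of 0] by eventually_elim (simp add: True)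
  then show ?thesis
    by (rule tendsto_eventually)
next
  case False
  with assms have "0 < q" by simp
  with assms(2) show ?thesis by real_asymp
qed

text \<open>Only orders \<open>N k\<close> are controlled, so the expansion of the
  \<open>m\<close>-th derivative is cut where its remainder involves exactly the derivative of order
  \<open>N k\<close>. The quotient of factorials left over is polynomial in \<open>N k\<close> and
  loses to the geometric factor \<open>q ^ (N k - m)\<close>.\<close>

lemma nth_deriv_taylor_tendsto:
  assumes ab: "a < b" and N: "strict_mono N" and f: "f \<in> C_infinity a b"
    and A: "A > 0" and M: "\<And>k. M_sup a b (N k) f \<le> B * A ^ N k * fact (N k)"
    and c: "c \<in> {a..b}" and x: "x \<in> {a..b}" and small: "A * \<bar>x - c\<bar> < 1"
  shows "(\<lambda>k. \<Sum>i<N k - m. nth_deriv a b (m + i) f c / fact i * (x - c) ^ i)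
           \<longlonglongrightarrow> nth_deriv a b m f x"
proof -
  define q where "q = A * \<bar>x - c\<bar>"
  define e where "e p = B * A ^ m * ((real p + real m) ^ Suc m * q ^ p)" for p :: nat
  have "e \<longlonglongrightarrow> 0"
    unfolding e_def using polynomial_times_power_tendsto_0[of q m "Suc m"] A small
    by (intro tendsto_mult_right_zero) (auto simp: q_def)
  moreover have lim: "filterlim (\<lambda>k. N k - m) at_top sequentially"
    using filterlim_compose[OF filterlim_minus_const_nat_at_top filterlim_subseq[OF N]] .
  ultimately have e0: "(\<lambda>k. e (N k - m)) \<longlonglongrightarrow> 0"
    by (rule filterlim_compose)
  have "\<forall>\<^sub>F k in sequentially. norm ((\<Sum>i<N k - m. nth_deriv a b (m + i) f c / fact i * (x - c) ^ i)
           - nth_deriv a b m f x) \<le> e (N k - m)"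
    using filterlim_subseq[OF N, unfolded filterlim_at_top, THEN spec, of "Suc m"]
  proof eventually_elim
    case (elim k)
    \<comment> \<open>Taylor degree chosen so that the remainder has order
      \<open>m + Suc n = N k\<close>.\<close>
    define n where "n = N k - Suc m"
    have Nk: "N k = Suc (m + n)" and Nkm: "N k - m = Suc n"
      using elim by (auto simp: n_def)
    \<comment> \<open>The sign of \<open>B\<close> follows from its bounding an absolute
      value.\<close>
    have "0 \<le> B * (A ^ N k * fact (N k))"
      using order_trans[OF abs_ge_zero order_trans[OF abs_nth_deriv_le_M_sup[OF f c] M[of k]]]
      by (simp add: mult.assoc)
    moreover have "0 < A ^ N k * fact (N k)"
      using A by simp
    ultimately have B: "B \<ge> 0"
      by (metis zero_le_mult_iff not_le)
    have "norm (nth_deriv a b (m + 0) f x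
        - (\<Sum>i\<le>n. nth_deriv a b (m + i) f c * (x - c) ^ i / fact i))
        \<le> (B * A ^ N k * fact (N k)) * norm (x - c) ^ Suc n / fact n"
    proof (rule field_Taylor[where S = "{a..b}" and f = "\<lambda>i. nth_deriv a b (m + i) f"])
      fix y assume "y \<in> {a..b}"
      then show "norm (nth_deriv a b (m + Suc n) f y) \<le> B * A ^ N k * fact (N k)"
        using order_trans[OF abs_nth_deriv_le_M_sup[OF f] M[of k]] by (simp add: Nk)
    qed (use nth_deriv_has_field_derivative[OF ab f] c x in auto)
    also have "\<dots> = B * A ^ m * q ^ Suc n * (fact (N k) / fact n)"
      by (simp add: Nk q_def power_mult_distrib power_add mult_ac)
    also have "\<dots> \<le> B * A ^ m * q ^ Suc n * real (N k) ^ Suc m"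
    proof (rule mult_left_mono)
      have "fact (N k) / fact n = real (fact (N k) div fact n)"
        by (subst real_of_nat_div) (auto intro: fact_dvd simp: Nk simp del: fact_Suc)
      also have "\<dots> \<le> real (N k ^ (N k - n))"
        using fact_div_fact_le_pow[of "N k - n" "N k"] by (intro of_nat_mono) (simp add: Nk)
      also have "N k - n = Suc m"
        by (simp add: Nk)
      finally show "fact (N k) / fact n \<le> real (N k) ^ Suc m"
        by simp
    qed (use A B in \<open>auto simp: q_def\<close>)
    also have "\<dots> = e (N k - m)"
      unfolding e_def Nkm by (simp add: Nk add_ac mult_ac del: power_Suc)
    also have "(\<Sum>i\<le>n. nth_deriv a b (m + i) f c * (x - c) ^ i / fact i)
        = (\<Sum>i<N k - m. nth_deriv a b (m + i) f c / fact i * (x - c) ^ i)"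
      unfolding Nkm lessThan_Suc_atMost by simp
    finally show ?case
      by (subst norm_minus_commute) simp
  qed
  then show ?thesis
    by (rule LIM_zero_cancel[OF Lim_null_comparison]) (fact e0)
qed

lemma nth_deriv_mono_step:
  fixes N :: "nat \<Rightarrow> nat"
  assumes ab: "a < b" and N: "strict_mono N" and f: "f \<in> C_infinity a b"
    and A: "A > 0" and M: "\<And>k. M_sup a b (N k) f \<le> B * A ^ N k * fact (N k)"
    and c: "c \<in> {a..b}" and x: "x \<in> {a..b}" and small: "A * \<bar>x - c\<bar> < 1" and "c \<le> x"
    and nonneg: "\<And>n. nth_deriv a b n f c \<ge> 0"
  shows "nth_deriv a b m f c \<le> nth_deriv a b m f x"
proof (rule tendsto_lowerbound[OF nth_deriv_taylor_tendsto[where N = N, OF ab N f A M c x small]])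
  show "\<forall>\<^sub>F k in sequentially. nth_deriv a b m f c
      \<le> (\<Sum>i<N k - m. nth_deriv a b (m + i) f c / fact i * (x - c) ^ i)"
    \<comment> \<open>From \<open>N k \<ge> Suc m\<close> on, the sum contains its
      \<open>i = 0\<close> term, which alone gives the bound.\<close>
    using filterlim_subseq[OF N, unfolded filterlim_at_top, THEN spec, of "Suc m"]
  proof eventually_elim
    case (elim k)
    then have "(\<Sum>i<1. nth_deriv a b (m + i) f c / fact i * (x - c) ^ i)
        \<le> (\<Sum>i<N k - m. nth_deriv a b (m + i) f c / fact i * (x - c) ^ i)"
      using nonneg \<open>c \<le> x\<close> by (intro sum_mono2) auto
    then show ?case by simp
  qed
qed auto

lemma C_class_derivs_pos:
  assumes ab: "a < b" and N: "strict_mono N" and f: "f \<in> C_class N a b"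
    and pos: "\<And>n. nth_deriv a b n f a > 0" and x: "x \<in> {a..b}"
  shows "nth_deriv a b m f x > 0"
proof -
  obtain A B where A: "A > 0" and M: "\<And>k. M_sup a b (N k) f \<le> B * A ^ N k * fact (N k)"
    and f': "f \<in> C_infinity a b"
    using f by (auto simp: C_class_def)
  \<comment> \<open>Half the radius \<open>1 / A\<close>, so a full step \<open>d\<close> stays
    strictly inside.\<close>
  define d where "d = 1 / (2 * A)"
  have d: "d > 0" "A * d < 1" using A by (auto simp: d_def)
  have "\<forall>x\<in>{a..b}. x \<le> a + real j * d \<longrightarrow> (\<forall>m. nth_deriv a b m f x > 0)" for j
  proof (induction j)
    case 0
    then show ?case using pos by auto
  next
    case (Suc j)
    show ?case
    proof (intro ballI impI allI)
      fix x m assume x: "x \<in> {a..b}" "x \<le> a + real (Suc j) * d"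
      \<comment> \<open>One step back from \<open>x\<close>, clipped at \<open>a\<close>:
        \<open>c\<close> stays in the interval and falls under the induction hypothesis.\<close>
      define c where "c = max a (x - d)"
      have c: "c \<in> {a..b}" "c \<le> x" "c \<le> a + real j * d" "x - c \<le> d"
        using x d(1) by (auto simp: c_def algebra_simps)
      have "A * (x - c) \<le> A * d"
        using c(4) A by simp
      then have "A * \<bar>x - c\<bar> < 1"
        using c(2) d(2) by simp
      moreover have pc: "nth_deriv a b n f c > 0" for n
        using Suc.IH c by auto
      ultimately show "nth_deriv a b m f x > 0"
        using nth_deriv_mono_step[where N = N, OF ab N f' A M c(1) x(1) _ c(2), of m] pc
        by (meson less_imp_le less_le_trans)
    qed
  qed
  moreover obtain j where "x - a < real j * d"
    using reals_Archimedean3[OF d(1)] by blast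
  then have "x \<le> a + real j * d" by simp
  ultimately show ?thesis
    using x by blast
qed

text \<open>The reciprocals are the terms of the exponential series at \<open>1 / h\<close>, hence
  positive and null.\<close>

lemma fact_times_power_at_top:
  fixes h :: real
  assumes "h > 0"
  shows "filterlim (\<lambda>i. fact i * h ^ i) at_top sequentially"
proof -
  have "(\<lambda>i. inverse (fact i) * (1 / h) ^ i) \<longlonglongrightarrow> 0"
    by (intro summable_LIMSEQ_zero summable_exp)
  then have "filterlim (\<lambda>i. inverse (inverse (fact i) * (1 / h) ^ i)) at_top sequentially"
    by (rule filterlim_inverse_at_top) (use assms in auto)
  then show ?thesis
    by (simp add: power_divide field_simps)
qed

lemma C_class_no_factorial_jet:
  assumes ab: "a < b" and N: "strict_mono N" and f: "f \<in> C_class N a b"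
    and c: "c \<in> {a..b}" and s: "s = 1 \<and> c < b \<or> s = -1 \<and> a < c"
  shows "Borel_map a b c f \<noteq> Abs_fps (\<lambda>n. s ^ n * fact n)"
proof
  assume jet: "Borel_map a b c f = Abs_fps (\<lambda>n. s ^ n * fact n)"
  have coeff: "nth_deriv a b n f c / fact n = s ^ n * fact n" for n
    using arg_cong[OF jet, of "\<lambda>F. fps_nth F n"] by (simp add: Borel_map_def)
  obtain A B where A: "A > 0" and M: "\<And>k. M_sup a b (N k) f \<le> B * A ^ N k * fact (N k)"
    and f': "f \<in> C_infinity a b"
    using f by (auto simp: C_class_def)
  \<comment> \<open>Small enough for Taylor convergence and for \<open>c + s * h\<close> to remain
    in the interval.\<close>
  define h where "h = min (1 / (2 * A)) (if s = 1 then b - c else c - a)"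
  have "h > 0"
    using A s by (auto simp: h_def)
  moreover have "h \<le> 1 / (2 * A)" "h \<le> (if s = 1 then b - c else c - a)"
    unfolding h_def by (rule min.cobounded1 min.cobounded2)+
  ultimately have h: "h > 0" "h \<le> 1 / (2 * A)" "c + s * h \<in> {a..b}"
    using s c by auto
  have "A * h \<le> A * (1 / (2 * A))"
    using h A by (intro mult_left_mono) auto
  then have small: "A * \<bar>c + s * h - c\<bar> < 1"
    using A h s by (auto simp: abs_mult)
  \<comment> \<open>The sign in the jet cancels the sign of \<open>(s * h) ^ i\<close>, making all
    terms positive.\<close>
  have ss: "s ^ i * s ^ i = 1" for i
    using s by (auto simp flip: power_mult_distrib)
  have term_eq: "nth_deriv a b (0 + i) f c / fact i * (c + s * h - c) ^ i = fact i * h ^ i" for i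
  proof -
    have "nth_deriv a b (0 + i) f c / fact i * (c + s * h - c) ^ i = (s ^ i * s ^ i) * (fact i * h ^ i)"
      using coeff[of i] by (simp add: power_mult_distrib)
    then show ?thesis by (simp only: ss mult_1)
  qed
  have lim: "(\<lambda>k. \<Sum>i<N k. fact i * h ^ i) \<longlonglongrightarrow> f (c + s * h)"
    using nth_deriv_taylor_tendsto[where N = N, OF ab N f' A M c h(3) small, of 0]
    unfolding term_eq by (simp add: nth_deriv_def)
  have "filterlim (\<lambda>n. \<Sum>i<n. fact i * h ^ i) at_top sequentially"
  \<comment> \<open>After the shift, the partial sum includes the term of index \<open>n\<close> and
    dominates it.\<close>
  proof (rule filterlim_sequentially_Suc[THEN iffD1],
      rule filterlim_at_top_mono[OF fact_times_power_at_top[OF h(1)]])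
    show "\<forall>\<^sub>F n in sequentially. fact n * h ^ n \<le> (\<Sum>i<Suc n. fact i * h ^ i)"
      using h(1) by (intro always_eventually) (auto intro!: sum_nonneg)
  qed
  then have "filterlim (\<lambda>k. \<Sum>i<N k. fact i * h ^ i) at_top sequentially"
    using filterlim_subseq[OF N] by (rule filterlim_compose)
  then show False
    using not_tendsto_and_filterlim_at_infinity[OF _ lim] filterlim_at_top_imp_at_infinity by auto
qed

theorem mainTheorem1:
  fixes a b :: real and N :: "nat \<Rightarrow> nat"
  assumes "a < b" and "strict_mono N"
  shows "(\<forall>f\<in>C_class N a b. (\<forall>n. nth_deriv a b n f a > 0) \<longrightarrow>
            (\<forall>n. \<forall>x\<in>{a..b}. nth_deriv a b n f x > 0)) \<and>
         (C_analytic a b \<subset> C_class N a b \<longrightarrow>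
            (\<forall>c\<in>{a..b}. Borel_map a b c ` C_class N a b \<noteq> UNIV))"
proof (intro conjI ballI impI allI)
  fix f n x
  assume "f \<in> C_class N a b" "\<forall>n. nth_deriv a b n f a > 0" "x \<in> {a..b}"
  then show "nth_deriv a b n f x > 0"
    using C_class_derivs_pos[OF assms] by blast
next
  fix c assume c: "c \<in> {a..b}"
  obtain s :: real where "s = 1 \<and> c < b \<or> s = -1 \<and> a < c"
    using c assms(1) by (cases "c < b") auto
  then have "Abs_fps (\<lambda>n. s ^ n * fact n) \<notin> Borel_map a b c ` C_class N a b"
    using C_class_no_factorial_jet[OF assms _ c] by fastforce
  then show "Borel_map a b c ` C_class N a b \<noteq> UNIV"
    by blast
qed

end
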